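(* Let $\alpha\in[0,1]$ and consider the optimization problem $$\max_{q_1,R}\ R\quad\text{s.t.}\quad q_1\in[x_1,x_2],\ R\ge 0,\ f^{(1)}(q_1)\ge(1-\alpha)R,\ f^{(2)}(q_1)\ge\alpha R,$$ where $$f^{(1)}(x)=\log_2\!\left(1+\frac{\frac{\eta P_1}{d_1^2+(x_1-x)^2}}{\frac{\eta P_2}{d_2^2+(x_2-x)^2}+\sigma^2}\right),\qquad f^{(2)}(x)=\log_2\!\left(1+\frac{\eta P_2/\sigma^2}{d_2^2+(x_2-x)^2}\right).$$ Then the optimal $q_1$ is $$q^{\alpha}=\begin{cases}x_1 & \text{if } \frac1\alpha f^{(2)}(x_1)>\frac1{1-\alpha}f^{(1)}(x_1),\\ x_2 & \text{if } \frac1{1-\alpha}f^{(1)}(x_2)>\frac1\alpha f^{(2)}(x_2),\\ x_\alpha^\star & \text{otherwise,}\end{cases}$$ where $x_\alpha^\star$ is the solution $x\in[x_1,x_2]$ of $\frac1\alpha f^{(2)}(x)=\frac1{1-\alpha}f^{(1)}(x)$.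
   Context: Here $x_1\le x_2$ are real numbers (the users' coordinates along the waveguide), and $d_1,d_2,P_1,P_2,\eta,\sigma^2>0$ are constants. The functions $f^{(1)},f^{(2)}$ are the uplink rates of user 1 (decoded first, treating user 2 as interference) and user 2 (decoded second) under successive interference cancellation, when a single antenna is activated at coordinate $x$. For $\alpha=0$ the quantity $\frac1\alpha f^{(2)}(x)$ is read as $+\infty$, and for $\alpha=1$ the quantity $\frac1{1-\alpha}f^{(1)}(x)$ is read as $+\infty$. *)

theory Defs
  imports Complex_Main "HOL-Library.Extended_Real"
begin

text \<open>Uplink rates under successive interference cancellation with the antenna activated at
  coordinate \<open>x\<close>: user 1 is decoded first, treating user 2 as interference.\<close>

definition sic_rate1 ::
  "real \<Rightarrow> real \<Rightarrow> real \<Rightarrow> real \<Rightarrow> real \<Rightarrow> real \<Rightarrow> real \<Rightarrow> real \<Rightarrow> real \<Rightarrow> real" where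
  "sic_rate1 \<eta> \<sigma> P1 P2 d1 d2 x1 x2 x =
     log 2 (1 + (\<eta> * P1 / (d1\<^sup>2 + (x1 - x)\<^sup>2)) / (\<eta> * P2 / (d2\<^sup>2 + (x2 - x)\<^sup>2) + \<sigma>\<^sup>2))"

definition sic_rate2 :: "real \<Rightarrow> real \<Rightarrow> real \<Rightarrow> real \<Rightarrow> real \<Rightarrow> real \<Rightarrow> real" where
  "sic_rate2 \<eta> \<sigma> P2 d2 x2 x =
     log 2 (1 + (\<eta> * P2 / \<sigma>\<^sup>2) / (d2\<^sup>2 + (x2 - x)\<^sup>2))"

definition feasible ::
  "(real \<Rightarrow> real) \<Rightarrow> (real \<Rightarrow> real) \<Rightarrow> real \<Rightarrow> real \<Rightarrow> real \<Rightarrow> real \<times> real \<Rightarrow> bool" where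
  "feasible f1 f2 x1 x2 \<alpha> = (\<lambda>(q, R).
     q \<in> {x1..x2} \<and> R \<ge> 0 \<and> f1 q \<ge> (1 - \<alpha>) * R \<and> f2 q \<ge> \<alpha> * R)"

text \<open>The positions \<open>q\<close> that occur in some maximizer \<open>(q, R)\<close> of the objective \<open>R\<close>.\<close>

definition optimal_positions ::
  "(real \<Rightarrow> real) \<Rightarrow> (real \<Rightarrow> real) \<Rightarrow> real \<Rightarrow> real \<Rightarrow> real \<Rightarrow> real set" where
  "optimal_positions f1 f2 x1 x2 \<alpha> = {q. \<exists>R. is_arg_max snd (feasible f1 f2 x1 x2 \<alpha>) (q, R)}"

text \<open>The quantity \<open>r / a\<close>, read as \<open>\<infinity>\<close> for \<open>a = 0\<close> (where division on the reals would give 0).\<close>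

definition scaled_rate :: "real \<Rightarrow> real \<Rightarrow> ereal" where
  "scaled_rate a r = (if a = 0 then \<infinity> else ereal (1 / a * r))"

definition left_case :: "(real \<Rightarrow> real) \<Rightarrow> (real \<Rightarrow> real) \<Rightarrow> real \<Rightarrow> real \<Rightarrow> bool" where
  "left_case f1 f2 x1 \<alpha> \<longleftrightarrow> scaled_rate \<alpha> (f2 x1) > scaled_rate (1 - \<alpha>) (f1 x1)"

definition right_case :: "(real \<Rightarrow> real) \<Rightarrow> (real \<Rightarrow> real) \<Rightarrow> real \<Rightarrow> real \<Rightarrow> bool" where
  "right_case f1 f2 x2 \<alpha> \<longleftrightarrow> scaled_rate (1 - \<alpha>) (f1 x2) > scaled_rate \<alpha> (f2 x2)"

definition balanced ::
  "(real \<Rightarrow> real) \<Rightarrow> (real \<Rightarrow> real) \<Rightarrow> real \<Rightarrow> real \<Rightarrow> real \<Rightarrow> real \<Rightarrow> bool" where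
  "balanced f1 f2 x1 x2 \<alpha> x \<longleftrightarrow>
     x \<in> {x1..x2} \<and> scaled_rate \<alpha> (f2 x) = scaled_rate (1 - \<alpha>) (f1 x)"

definition q_opt ::
  "(real \<Rightarrow> real) \<Rightarrow> (real \<Rightarrow> real) \<Rightarrow> real \<Rightarrow> real \<Rightarrow> real \<Rightarrow> real" where
  "q_opt f1 f2 x1 x2 \<alpha> =
     (if left_case f1 f2 x1 \<alpha> then x1
      else if right_case f1 f2 x2 \<alpha> then x2
      else (THE x. balanced f1 f2 x1 x2 \<alpha> x))"

end

theory Submission
  imports Defs
begin

text \<open>On \<open>[x1, x2]\<close> the rate \<open>f1\<close> is strictly decreasing and \<open>f2\<close> is strictly increasing.  The best
  \<open>R\<close> at position \<open>q\<close> is the minimum of the two scaled rates, so moving right of the optimum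
  lowers the first and moving left lowers the second; the optimum is the crossing point of the two
  scaled rates, or an endpoint if they do not cross.\<close>

text \<open>An optimality certificate: for \<open>\<alpha>\<close> in [0,1] a pair with
  \<open>R' \<ge> R\<close> demands at least as much of both users as \<open>R\<close> does, so away
  from \<open>q\<close> one of \<open>right\<close> and \<open>left\<close> rules it out. At
  \<open>q\<close> itself, \<open>tight\<close> bounds the objective.\<close>

lemma optimal_positions_eqI:
  assumes feas: "feasible f1 f2 x1 x2 \<alpha> (q, R)"
    and \<alpha>: "\<alpha> \<in> {0..1}"
    and right: "\<And>y. y \<in> {x1..x2} \<Longrightarrow> q < y \<Longrightarrow> f1 y < (1 - \<alpha>) * R"
    and left: "\<And>y. y \<in> {x1..x2} \<Longrightarrow> y < q \<Longrightarrow> f2 y < \<alpha> * R"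
    and tight: "\<alpha> < 1 \<and> f1 q = (1 - \<alpha>) * R \<or> 0 < \<alpha> \<and> f2 q = \<alpha> * R"
  shows "optimal_positions f1 f2 x1 x2 \<alpha> = {q}"
proof -
  have less: "R' < R" if "feasible f1 f2 x1 x2 \<alpha> (y, R')" "y \<noteq> q" for y R'
  proof (rule ccontr)
    assume "\<not> R' < R"
    then have "(1 - \<alpha>) * R \<le> (1 - \<alpha>) * R'" "\<alpha> * R \<le> \<alpha> * R'"
      using \<alpha> by (auto intro!: mult_left_mono)
    with that right[of y] left[of y] show False
      by (fastforce simp: feasible_def neq_iff)
  qed
  \<comment> \<open>The factor of \<open>R\<close> in the tight constraint is positive, so it
    cancels.\<close>
  have le: "R' \<le> R" if "feasible f1 f2 x1 x2 \<alpha> (q, R')" for R'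
    using tight that by (auto simp: feasible_def)
  have "is_arg_max snd (feasible f1 f2 x1 x2 \<alpha>) (q, R)"
    unfolding is_arg_max_def using feas less le by (force simp: not_less)
  moreover have "y = q" if "is_arg_max snd (feasible f1 f2 x1 x2 \<alpha>) (y, R')" for y R'
    using that feas less[of y R'] unfolding is_arg_max_def by force
  ultimately show ?thesis
    unfolding optimal_positions_def by blast
qed

text \<open>The argument uses only monotonicity, continuity and nonnegativity of the rates, so it is
  carried out for abstract \<open>f1\<close> and \<open>f2\<close>.\<close>

lemma max_min_rate_position:
  fixes f1 f2 :: "real \<Rightarrow> real"
  assumes "x1 \<le> x2" and \<alpha>: "\<alpha> \<in> {0..1}"
    and anti: "strict_antimono_on {x1..x2} f1" and mono: "strict_mono_on {x1..x2} f2"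
    and cont: "continuous_on {x1..x2} f1" "continuous_on {x1..x2} f2"
    and nonneg: "\<And>x. x \<in> {x1..x2} \<Longrightarrow> f1 x \<ge> 0" "\<And>x. x \<in> {x1..x2} \<Longrightarrow> f2 x \<ge> 0"
  shows "\<not> (left_case f1 f2 x1 \<alpha> \<and> right_case f1 f2 x2 \<alpha>) \<and>
    (\<not> left_case f1 f2 x1 \<alpha> \<and> \<not> right_case f1 f2 x2 \<alpha>
       \<longrightarrow> (\<exists>!x. balanced f1 f2 x1 x2 \<alpha> x)) \<and>
    optimal_positions f1 f2 x1 x2 \<alpha> = {q_opt f1 f2 x1 x2 \<alpha>}"
proof -
  note defs = left_case_def right_case_def balanced_def scaled_rate_def
  have f1_less: "f1 y < f1 x" if "x \<in> {x1..x2}" "y \<in> {x1..x2}" "x < y" for x y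
    using monotone_onD[OF anti] that by auto
  have f2_less: "f2 x < f2 y" if "x \<in> {x1..x2}" "y \<in> {x1..x2}" "x < y" for x y
    using monotone_onD[OF mono] that by auto
  have ends: "x1 \<in> {x1..x2}" "x2 \<in> {x1..x2}"
    using \<open>x1 \<le> x2\<close> by auto
  \<comment> \<open>The infinite readings are resolved here: \<open>\<alpha> = 0\<close> forces the
    left case and \<open>\<alpha> = 1\<close> the right one. Elsewhere only real quotients are
    compared.\<close>
  have left_iff: "left_case f1 f2 x1 \<alpha> \<longleftrightarrow> \<alpha> < 1 \<and> (\<alpha> = 0 \<or> f1 x1 / (1 - \<alpha>) < f2 x1 / \<alpha>)"
    using \<alpha> by (auto simp: defs)
  have right_iff: "right_case f1 f2 x2 \<alpha> \<longleftrightarrow> 0 < \<alpha> \<and> (\<alpha> = 1 \<or> f2 x2 / \<alpha> < f1 x2 / (1 - \<alpha>))"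
    using \<alpha> by (auto simp: defs)
  have excl: "\<not> right_case f1 f2 x2 \<alpha>" if "left_case f1 f2 x1 \<alpha>"
  proof
    assume "right_case f1 f2 x2 \<alpha>"
    with that have a: "0 < \<alpha>" "\<alpha> < 1" and l: "f1 x1 / (1 - \<alpha>) < f2 x1 / \<alpha>"
      and r: "f2 x2 / \<alpha> < f1 x2 / (1 - \<alpha>)"
      by (auto simp: left_iff right_iff)
    \<comment> \<open>Monotonicity closes a cycle: f1 x1 / (1 - \<alpha>) < f2 x1 / \<alpha> \<le>
      f2 x2 / \<alpha> < f1 x2 / (1 - \<alpha>) \<le> f1 x1 / (1 - \<alpha>).\<close>
    have "f1 x2 \<le> f1 x1" "f2 x1 \<le> f2 x2"
      using f1_less[OF ends] f2_less[OF ends] \<open>x1 \<le> x2\<close> by (cases "x1 = x2"; force)+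
    then have "f1 x2 / (1 - \<alpha>) \<le> f1 x1 / (1 - \<alpha>)" "f2 x1 / \<alpha> \<le> f2 x2 / \<alpha>"
      using a by (auto intro: divide_right_mono)
    with l r show False by linarith
  qed
  have opt_left: "optimal_positions f1 f2 x1 x2 \<alpha> = {x1}" if "left_case f1 f2 x1 \<alpha>"
  \<comment> \<open>User 1 is the bottleneck: \<open>R\<close> makes its constraint tight, any move
    right violates it, and no position lies further left.\<close>
  proof (rule optimal_positions_eqI[OF _ \<alpha>, where R = "f1 x1 / (1 - \<alpha>)"])
    have a: "0 \<le> \<alpha>" "\<alpha> < 1" and l: "\<alpha> = 0 \<or> f1 x1 / (1 - \<alpha>) < f2 x1 / \<alpha>"
      using that \<alpha> by (auto simp: left_iff)
    have "\<alpha> * (f1 x1 / (1 - \<alpha>)) \<le> f2 x1"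
    \<comment> \<open>For \<open>\<alpha> = 0\<close> the goal reduces to nonnegativity of
      \<open>f2 x1\<close>.\<close>
    proof (cases "\<alpha> = 0")
      case True
      then show ?thesis using nonneg ends by simp
    next
      case False
      with a l show ?thesis by (simp add: field_simps)
    qed
    then show "feasible f1 f2 x1 x2 \<alpha> (x1, f1 x1 / (1 - \<alpha>))"
      using a nonneg ends by (simp add: feasible_def)
  qed (use that f1_less ends in \<open>auto simp: left_iff\<close>)
  have opt_right: "optimal_positions f1 f2 x1 x2 \<alpha> = {x2}" if "right_case f1 f2 x2 \<alpha>"
  \<comment> \<open>The mirror image: user 2 is the bottleneck, and \<open>\<alpha> = 1\<close> is
    the degenerate weight.\<close>
  proof (rule optimal_positions_eqI[OF _ \<alpha>, where R = "f2 x2 / \<alpha>"])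
    have a: "0 < \<alpha>" "\<alpha> \<le> 1" and r: "\<alpha> = 1 \<or> f2 x2 / \<alpha> < f1 x2 / (1 - \<alpha>)"
      using that \<alpha> by (auto simp: right_iff)
    have "(1 - \<alpha>) * (f2 x2 / \<alpha>) \<le> f1 x2"
    proof (cases "\<alpha> = 1")
      case True
      then show ?thesis using nonneg ends by simp
    next
      case False
      with a r show ?thesis by (simp add: field_simps)
    qed
    then show "feasible f1 f2 x1 x2 \<alpha> (x2, f2 x2 / \<alpha>)"
      using a nonneg ends by (simp add: feasible_def)
  qed (use that f2_less ends in \<open>auto simp: right_iff\<close>)
  have mid: "\<exists>!x. balanced f1 f2 x1 x2 \<alpha> x"
    and opt_mid: "optimal_positions f1 f2 x1 x2 \<alpha> = {THE x. balanced f1 f2 x1 x2 \<alpha> x}"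
    if "\<not> left_case f1 f2 x1 \<alpha>" "\<not> right_case f1 f2 x2 \<alpha>"
  proof -
    have a: "0 < \<alpha>" "\<alpha> < 1" and l: "f2 x1 / \<alpha> \<le> f1 x1 / (1 - \<alpha>)"
      and r: "f1 x2 / (1 - \<alpha>) \<le> f2 x2 / \<alpha>"
      using that \<alpha> by (auto simp: left_iff right_iff not_less)
    have bal: "balanced f1 f2 x1 x2 \<alpha> x \<longleftrightarrow> x \<in> {x1..x2} \<and> f2 x / \<alpha> = f1 x / (1 - \<alpha>)" for x
      using a by (auto simp: defs)
    \<comment> \<open>By \<open>l\<close> and \<open>r\<close> the difference is nonpositive at
      \<open>x1\<close> and nonnegative at \<open>x2\<close>.\<close>
    have "\<exists>x\<ge>x1. x \<le> x2 \<and> f2 x / \<alpha> - f1 x / (1 - \<alpha>) = 0"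
      by (rule IVT') (use l r a \<open>x1 \<le> x2\<close> cont in \<open>auto intro!: continuous_intros\<close>)
    then obtain x where x: "x \<in> {x1..x2}" and eq: "f2 x / \<alpha> = f1 x / (1 - \<alpha>)"
      by auto
    \<comment> \<open>At a balanced point one value of \<open>R\<close> makes both constraints
      tight, so a move in either direction violates one of them. Keeping \<open>y\<close> arbitrary
      also yields uniqueness.\<close>
    have opt: "optimal_positions f1 f2 x1 x2 \<alpha> = {y}"
      if y: "y \<in> {x1..x2}" and eq: "f2 y / \<alpha> = f1 y / (1 - \<alpha>)" for y
    proof (rule optimal_positions_eqI[OF _ \<alpha>, where R = "f2 y / \<alpha>"])
      have f1y: "(1 - \<alpha>) * (f2 y / \<alpha>) = f1 y"
        using a by (simp add: eq)
      show "feasible f1 f2 x1 x2 \<alpha> (y, f2 y / \<alpha>)"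
        using a y nonneg[OF y] f1y by (simp add: feasible_def)
      show "f1 z < (1 - \<alpha>) * (f2 y / \<alpha>)" if "z \<in> {x1..x2}" "y < z" for z
        unfolding f1y using f1_less y that by blast
      show "f2 z < \<alpha> * (f2 y / \<alpha>)" if "z \<in> {x1..x2}" "z < y" for z
        using f2_less[OF that(1) y that(2)] a by simp
    qed (use a in auto)
    have ex1: "\<exists>!x. balanced f1 f2 x1 x2 \<alpha> x"
      \<comment> \<open>Two balanced points would give the same set of optimal positions as two
        singletons, so they coincide.\<close>
      unfolding bal using x eq opt by (metis singleton_inject)
    then show "\<exists>!x. balanced f1 f2 x1 x2 \<alpha> x" .
    show "optimal_positions f1 f2 x1 x2 \<alpha> = {THE x. balanced f1 f2 x1 x2 \<alpha> x}"
      using theI'[OF ex1] opt unfolding bal by blast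
  qed
  show ?thesis
    using excl opt_left opt_right mid opt_mid unfolding q_opt_def by auto
qed

text \<open>Left of \<open>b\<close>, moving right shortens the distance to the user. It serves both
  the interference in \<open>f1\<close> and the signal in \<open>f2\<close>.\<close>

lemma strict_mono_on_received_power:
  fixes c d b :: real
  assumes "c > 0" "d > 0"
  shows "strict_mono_on {..b} (\<lambda>x. c / (d\<^sup>2 + (b - x)\<^sup>2))"
proof (rule strict_mono_onI)
  fix x y :: real
  assume "x \<in> {..b}" "y \<in> {..b}" "x < y"
  then have "(b - y)\<^sup>2 < (b - x)\<^sup>2"
    by (intro power_strict_mono) auto
  then show "c / (d\<^sup>2 + (b - x)\<^sup>2) < c / (d\<^sup>2 + (b - y)\<^sup>2)"
    using assms by (intro divide_strict_left_mono mult_pos_pos add_pos_nonneg) auto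
qed

lemma strict_antimono_on_received_power:
  fixes c d a :: real
  assumes "c > 0" "d > 0"
  shows "strict_antimono_on {a..} (\<lambda>x. c / (d\<^sup>2 + (a - x)\<^sup>2))"
proof (rule monotone_onI)
  fix x y :: real
  assume "x \<in> {a..}" "y \<in> {a..}" "x < y"
  \<comment> \<open>The differences are reversed to have nonnegative bases for the monotonicity of
    powers.\<close>
  then have "(x - a)\<^sup>2 < (y - a)\<^sup>2"
    by (intro power_strict_mono) auto
  then have "(a - x)\<^sup>2 < (a - y)\<^sup>2"
    by (simp add: power2_commute)
  then show "c / (d\<^sup>2 + (a - x)\<^sup>2) > c / (d\<^sup>2 + (a - y)\<^sup>2)"
    using assms by (intro divide_strict_left_mono mult_pos_pos add_pos_nonneg) auto
qed

text \<open>The first two conjuncts say that the case distinction in \<open>q_opt\<close> is sound: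
  its tests never compete, and its \<open>THE\<close> denotes a genuine point. The singleton in the
  third expresses that the optimum is attained and its position unique.\<close>

theorem theorem1:
  fixes x1 x2 d1 d2 P1 P2 \<eta> \<sigma> \<alpha> :: real
    and f1 f2 :: "real \<Rightarrow> real"
  assumes "x1 \<le> x2"
    and "d1 > 0" and "d2 > 0" and "P1 > 0" and "P2 > 0" and "\<eta> > 0" and "\<sigma>\<^sup>2 > 0"
    and "\<alpha> \<in> {0..1}"
    and "f1 = sic_rate1 \<eta> \<sigma> P1 P2 d1 d2 x1 x2"
    and "f2 = sic_rate2 \<eta> \<sigma> P2 d2 x2"
  shows "\<not> (left_case f1 f2 x1 \<alpha> \<and> right_case f1 f2 x2 \<alpha>) \<and>
    (\<not> left_case f1 f2 x1 \<alpha> \<and> \<not> right_case f1 f2 x2 \<alpha>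
       \<longrightarrow> (\<exists>!x. balanced f1 f2 x1 x2 \<alpha> x)) \<and>
    optimal_positions f1 f2 x1 x2 \<alpha> = {q_opt f1 f2 x1 x2 \<alpha>}"
proof -
  note [simp] = \<open>f1 = _\<close> \<open>f2 = _\<close>
  let ?p1 = "\<lambda>x. \<eta> * P1 / (d1\<^sup>2 + (x1 - x)\<^sup>2)"
  let ?p2 = "\<lambda>x. \<eta> * P2 / (d2\<^sup>2 + (x2 - x)\<^sup>2)"
  let ?s2 = "\<lambda>x. (\<eta> * P2 / \<sigma>\<^sup>2) / (d2\<^sup>2 + (x2 - x)\<^sup>2)"
  have dist_pos: "0 < d1\<^sup>2 + (x1 - x)\<^sup>2" "0 < d2\<^sup>2 + (x2 - x)\<^sup>2" for x
    using \<open>d1 > 0\<close> \<open>d2 > 0\<close> by (auto intro: add_pos_nonneg)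
  have p1_pos: "0 < ?p1 x" and p2_pos: "0 < ?p2 x" and s2_pos: "0 < ?s2 x" for x
    using assms dist_pos by (auto intro!: divide_pos_pos)
  have sinr_pos: "0 < ?p1 x / (?p2 x + \<sigma>\<^sup>2)" for x
    by (rule divide_pos_pos[OF p1_pos add_pos_pos[OF p2_pos \<open>\<sigma>\<^sup>2 > 0\<close>]])
  \<comment> \<open>Positivity of \<open>g\<close> keeps the argument of the logarithm above 1,
    hence away from 0.\<close>
  have cont_log: "continuous_on {x1..x2} (\<lambda>x. log 2 (1 + g x))"
    if "continuous_on {x1..x2} g" "\<And>x. 0 < g x" for g :: "real \<Rightarrow> real"
    unfolding log_def using that
    by (intro continuous_intros) (auto simp: add_pos_pos less_imp_neq[symmetric])
  show ?thesis
  proof (rule max_min_rate_position)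
    show "strict_antimono_on {x1..x2} f1"
    proof (rule monotone_onI)
      fix x y
      assume xy: "x \<in> {x1..x2}" "y \<in> {x1..x2}" "x < y"
      \<comment> \<open>Moving right takes the antenna away from user 1 and towards user 2: the
        signal weakens while the interference grows, so the quotient drops.\<close>
      have "?p1 y < ?p1 x"
        using monotone_onD[OF strict_antimono_on_received_power[of "\<eta> * P1" d1 x1], of x y] assms xy
        by simp
      moreover have "?p2 x + \<sigma>\<^sup>2 \<le> ?p2 y + \<sigma>\<^sup>2"
        using strict_mono_onD[OF strict_mono_on_received_power[of "\<eta> * P2" d2 x2], of x y] assms xy
        by simp
      ultimately have "?p1 y / (?p2 y + \<sigma>\<^sup>2) < ?p1 x / (?p2 x + \<sigma>\<^sup>2)"
        by (rule frac_less[OF less_imp_le[OF p1_pos] _ add_pos_pos[OF p2_pos \<open>\<sigma>\<^sup>2 > 0\<close>]])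
      then show "f1 x > f1 y"
        using sinr_pos[of x] sinr_pos[of y] by (simp add: sic_rate1_def)
    qed
    show "strict_mono_on {x1..x2} f2"
    proof (rule strict_mono_onI)
      fix x y
      assume "x \<in> {x1..x2}" "y \<in> {x1..x2}" "x < y"
      then have "?s2 x < ?s2 y"
        using strict_mono_onD[OF strict_mono_on_received_power[of "\<eta> * P2 / \<sigma>\<^sup>2" d2 x2], of x y] assms
        by simp
      then show "f2 x < f2 y"
        using s2_pos[of x] s2_pos[of y] by (simp add: sic_rate2_def)
    qed
    have "continuous_on {x1..x2} (\<lambda>x. ?p1 x / (?p2 x + \<sigma>\<^sup>2))"
    proof (intro continuous_intros ballI)
      show "?p2 x + \<sigma>\<^sup>2 \<noteq> 0" for x
        using p2_pos[of x] \<open>\<sigma>\<^sup>2 > 0\<close> by linarith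
    qed (use dist_pos in \<open>auto simp: less_le\<close>)
    then show "continuous_on {x1..x2} f1"
      unfolding \<open>f1 = _\<close> sic_rate1_def using sinr_pos by (rule cont_log)
    have "continuous_on {x1..x2} ?s2"
      by (intro continuous_intros ballI) (use dist_pos in \<open>auto simp: less_le\<close>)
    then show "continuous_on {x1..x2} f2"
      unfolding \<open>f2 = _\<close> sic_rate2_def using s2_pos by (rule cont_log)
    show "f1 x \<ge> 0" "f2 x \<ge> 0" for x
      using sinr_pos[of x] s2_pos[of x] by (simp_all add: sic_rate1_def sic_rate2_def)
  qed (use assms in auto)
qed

end
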